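(* Let $H=(h_{ij})$ be an $n\times n$ $\{\pm1\}$-matrix which is standardized, i.e. $h_{1k}=h_{k1}=1$ for all $k$, and let $G$ be its $n$-full oriented hypergraph. Then the entries of $H$ are determined by the signs of the contributors $c_{(1k)}$, $c_{(k\ell)}$, $c_{(1k\ell)}$ of $\mathcal{A}_{id}$ as follows: (1) $h_{kk}=-(-1)^{pc(c_{(1k)})}$ for $2\le k\le n$; (2) $h_{k\ell}=(-1)^{pc(c_{(1k\ell)})}\cdot(-1)^{pc(c_{(1k)})}\cdot(-1)^{pc(c_{(1\ell)})}$ for $2\le k<\ell\le n$; (3) $h_{\ell k}=-(-1)^{pc(c_{(1k\ell)})}\cdot(-1)^{pc(c_{(k\ell)})}$ for $2\le k<\ell\le n$.
   Context: The $n$-full oriented hypergraph $G$ of $H$ has vertices $v_1,\dots,v_n$, edges $e_1,\dots,e_n$, and exactly one incidence $(v_i,e_j)$ for each pair $i,j$, with orientation $\sigma(v_i,e_j)=h_{ij}$. A step is a triple $(v,e,w)$ (tail vertex $v$, edge $e$, head vertex $w$) with sign $-\sigma(v,e)\sigma(w,e)$; it is a backstep if $w=v$ (sign $-1$). A contributor consists of one step $(v,f(v),\pi(v))$ for each vertex $v$, with $f:V\to E$ a function and $\pi$ a permutation of $V$; its components are the cycles of $\pi$, the sign of a component is the product of the signs of its steps, and $pc(c)$ is the number of components of sign $+1$. $\mathcal{A}_{id}$ is the set of contributors with $f(v_j)=e_j$ for all $j$. Within $\mathcal{A}_{id}$: $c_{(1k)}$ ($2\le k\le n$) has steps $(v_1,e_1,v_k)$,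 $(v_k,e_k,v_1)$ and backsteps $(v_j,e_j,v_j)$ at all other vertices; $c_{(k\ell)}$ ($2\le k<\ell\le n$) has steps $(v_k,e_k,v_\ell)$, $(v_\ell,e_\ell,v_k)$ and backsteps elsewhere; $c_{(1k\ell)}$ ($2\le k<\ell\le n$) has steps $(v_1,e_1,v_\ell)$, $(v_\ell,e_\ell,v_k)$, $(v_k,e_k,v_1)$ (so its 3-cycle uses exactly the incidences $(v_1,e_1),(v_1,e_k),(v_k,e_k),(v_k,e_\ell),(v_\ell,e_\ell),(v_\ell,e_1)$) and backsteps elsewhere. *)

theory Defs
  imports Main "HOL-Library.FuncSet" "HOL-Combinatorics.Permutations" "HOL-Combinatorics.Orbits"
begin

text \<open>Oriented hypergraphs in which a vertex-edge pair carries at most one incidence.\<close>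

record ('v, 'e) hypergraph =
  verts :: "'v set"
  edges :: "'e set"
  incidences :: "('v \<times> 'e) set"
  orient :: "'v \<Rightarrow> 'e \<Rightarrow> int"

definition oriented_hypergraph :: "('v, 'e) hypergraph \<Rightarrow> bool" where
  "oriented_hypergraph G \<longleftrightarrow>
     finite (verts G) \<and> finite (edges G) \<and> incidences G \<subseteq> verts G \<times> edges G \<and>
     (\<forall>(v, e) \<in> incidences G. orient G v e \<in> {1, -1})"

text \<open>A step is a triple (tail, edge, head).\<close>

definition is_step :: "('v, 'e) hypergraph \<Rightarrow> 'v \<times> 'e \<times> 'v \<Rightarrow> bool" where
  "is_step G = (\<lambda>(v, e, w). (v, e) \<in> incidences G \<and> (w, e) \<in> incidences G)"

definition step_sign :: "('v, 'e) hypergraph \<Rightarrow> 'v \<times> 'e \<times> 'v \<Rightarrow> int" where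
  "step_sign G = (\<lambda>(v, e, w). - (orient G v e * orient G w e))"

record ('v, 'e) contributor =
  cedge :: "'v \<Rightarrow> 'e"
  cperm :: "'v \<Rightarrow> 'v"

definition step_at :: "('v, 'e) contributor \<Rightarrow> 'v \<Rightarrow> 'v \<times> 'e \<times> 'v" where
  "step_at c v = (v, cedge c v, cperm c v)"

text \<open>The maps are normalised outside the vertex set (undefined, respectively the identity), so
  that equality of contributors is equality of the underlying maps on the vertex set.\<close>

definition is_contributor :: "('v, 'e) hypergraph \<Rightarrow> ('v, 'e) contributor \<Rightarrow> bool" where
  "is_contributor G c \<longleftrightarrow>
     cedge c \<in> verts G \<rightarrow>\<^sub>E edges G \<and> cperm c permutes verts G \<and>
     (\<forall>v \<in> verts G. is_step G (step_at c v))"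

text \<open>Components are represented by the vertex sets of the cycles of the permutation; fixed points
  (backsteps) are cycles of length one and count as components.\<close>

definition components_of :: "('v, 'e) hypergraph \<Rightarrow> ('v, 'e) contributor \<Rightarrow> 'v set set" where
  "components_of G c = orbit (cperm c) ` verts G"

definition component_sign :: "('v, 'e) hypergraph \<Rightarrow> ('v, 'e) contributor \<Rightarrow> 'v set \<Rightarrow> int" where
  "component_sign G c K = (\<Prod>v\<in>K. step_sign G (step_at c v))"

definition pc :: "('v, 'e) hypergraph \<Rightarrow> ('v, 'e) contributor \<Rightarrow> nat" where
  "pc G c = card {K \<in> components_of G c. component_sign G c K = 1}"

text \<open>A matrix is a function of which only the entries with indices in \<open>{1..n}\<close> matter.\<close>

definition sign_matrix :: "nat \<Rightarrow> (nat \<Rightarrow> nat \<Rightarrow> int) \<Rightarrow> bool" where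
  "sign_matrix n h \<longleftrightarrow> (\<forall>i\<in>{1..n}. \<forall>j\<in>{1..n}. h i j \<in> {1, -1})"

definition standardized :: "nat \<Rightarrow> (nat \<Rightarrow> nat \<Rightarrow> int) \<Rightarrow> bool" where
  "standardized n h \<longleftrightarrow> (\<forall>k\<in>{1..n}. h 1 k = 1 \<and> h k 1 = 1)"

text \<open>The number \<open>i\<close> stands for the vertex \<open>v\<^sub>i\<close> as a vertex and for the edge \<open>e\<^sub>i\<close> as an edge.\<close>

definition full_hypergraph :: "nat \<Rightarrow> (nat \<Rightarrow> nat \<Rightarrow> int) \<Rightarrow> (nat, nat) hypergraph" where
  "full_hypergraph n h =
     \<lparr>verts = {1..n}, edges = {1..n}, incidences = {1..n} \<times> {1..n}, orient = h\<rparr>"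

definition A_id :: "nat \<Rightarrow> (nat \<Rightarrow> nat \<Rightarrow> int) \<Rightarrow> (nat, nat) contributor set" where
  "A_id n h = {c. is_contributor (full_hypergraph n h) c \<and> (\<forall>j\<in>{1..n}. cedge c j = j)}"

definition id_contributor :: "nat \<Rightarrow> (nat \<Rightarrow> nat) \<Rightarrow> (nat, nat) contributor" where
  "id_contributor n p = \<lparr>cedge = restrict id {1..n}, cperm = p\<rparr>"

definition c_2cycle :: "nat \<Rightarrow> nat \<Rightarrow> nat \<Rightarrow> (nat, nat) contributor" where
  "c_2cycle n k l = id_contributor n (transpose k l)"

text \<open>The 3-cycle written \<open>(1 k l)\<close> is traversed as \<open>1 \<mapsto> l \<mapsto> k \<mapsto> 1\<close>.\<close>

definition c_3cycle :: "nat \<Rightarrow> nat \<Rightarrow> nat \<Rightarrow> (nat, nat) contributor" where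
  "c_3cycle n k l = id_contributor n (id(1 := l, l := k, k := 1))"

lemma oriented_hypergraph_full_hypergraph:
  "sign_matrix n h \<Longrightarrow> oriented_hypergraph (full_hypergraph n h)"
  by (auto simp: sign_matrix_def oriented_hypergraph_def full_hypergraph_def)

lemma id_contributor_in_A_id:
  assumes "p permutes {1..n}"
  shows "id_contributor n p \<in> A_id n h"
  using assms permutes_in_image[OF assms]
  by (auto simp: A_id_def is_contributor_def id_contributor_def full_hypergraph_def
      is_step_def step_at_def)

lemma c_2cycle_in_A_id:
  assumes "1 \<le> k" "k < l" "l \<le> n"
  shows "c_2cycle n k l \<in> A_id n h"
  unfolding c_2cycle_def
  by (rule id_contributor_in_A_id, rule permutes_swap_id) (use assms in auto)

lemma c_3cycle_in_A_id:
  assumes "2 \<le> k" "k < l" "l \<le> n"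
  shows "c_3cycle n k l \<in> A_id n h"
  unfolding c_3cycle_def
proof (rule id_contributor_in_A_id)
  have "id(1 := l, l := k, k := 1) = transpose k l \<circ> transpose 1 k"
    using assms by (auto simp: fun_eq_iff transpose_def)
  moreover have "transpose k l \<circ> transpose 1 k permutes {1..n}"
    by (rule permutes_compose; rule permutes_swap_id) (use assms in auto)
  ultimately show "id(1 := l, l := k, k := 1) permutes {1..n}" by simp
qed

lemma steps_c_2cycle:
  assumes "1 \<le> k" "k < l" "l \<le> n"
  shows "step_at (c_2cycle n k l) ` {1..n} =
    {(k, k, l), (l, l, k)} \<union> (\<lambda>j. (j, j, j)) ` ({1..n} - {k, l})"
proof -
  have "{1..n} = {k, l} \<union> ({1..n} - {k, l})" using assms by auto
  then have "step_at (c_2cycle n k l) ` {1..n} =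
      step_at (c_2cycle n k l) ` {k, l} \<union> step_at (c_2cycle n k l) ` ({1..n} - {k, l})"
    by (metis image_Un)
  also have "step_at (c_2cycle n k l) ` ({1..n} - {k, l}) = (\<lambda>j. (j, j, j)) ` ({1..n} - {k, l})"
    by (rule image_cong) (auto simp: step_at_def c_2cycle_def id_contributor_def transpose_def)
  also have "step_at (c_2cycle n k l) ` {k, l} = {(k, k, l), (l, l, k)}"
    using assms by (auto simp: step_at_def c_2cycle_def id_contributor_def)
  finally show ?thesis .
qed

lemma steps_c_3cycle:
  assumes "2 \<le> k" "k < l" "l \<le> n"
  shows "step_at (c_3cycle n k l) ` {1..n} =
    {(1, 1, l), (l, l, k), (k, k, 1)} \<union> (\<lambda>j. (j, j, j)) ` ({1..n} - {1, k, l})"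
proof -
  have "{1..n} = {1, l, k} \<union> ({1..n} - {1, k, l})" using assms by auto
  then have "step_at (c_3cycle n k l) ` {1..n} =
      step_at (c_3cycle n k l) ` {1, l, k} \<union> step_at (c_3cycle n k l) ` ({1..n} - {1, k, l})"
    by (metis image_Un)
  also have "step_at (c_3cycle n k l) ` ({1..n} - {1, k, l}) =
      (\<lambda>j. (j, j, j)) ` ({1..n} - {1, k, l})"
    by (rule image_cong) (auto simp: step_at_def c_3cycle_def id_contributor_def)
  also have "step_at (c_3cycle n k l) ` {1, l, k} = {(1, 1, l), (l, l, k), (k, k, 1)}"
    using assms by (auto simp: step_at_def c_3cycle_def id_contributor_def)
  finally show ?thesis .
qed

end

theory Submission imports Defs
begin

text \<open>A backstep has sign \<open>-1\<close>, so if the permutation of a contributor fixes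
  everything outside a cycle \<open>C\<close>, then \<open>C\<close> is the only component that can be positive, and
  \<open>(-1) ^ pc\<close> is minus the sign of \<open>C\<close>.
  For the contributors in question that sign is an explicit product of entries of \<open>H\<close>, and the
  entries equal to \<open>1\<close> and the squares drop out.\<close>

lemma step_sign_in:
  assumes "oriented_hypergraph G" "is_step G s"
  shows "step_sign G s \<in> {1, -1}"
proof (cases s)
  case (fields v e w)
  with assms have "orient G v e \<in> {1, -1}" "orient G w e \<in> {1, -1}"
    by (fastforce simp: oriented_hypergraph_def is_step_def)+
  then show ?thesis using fields by (auto simp: step_sign_def)
qed

lemma step_sign_backstep:
  assumes "oriented_hypergraph G" "is_step G (v, e, v)"
  shows "step_sign G (v, e, v) = -1"
  using assms by (fastforce simp: oriented_hypergraph_def is_step_def step_sign_def)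

text \<open>The signs are closed under multiplication. A product over an infinite set is 1 by
  convention, which is a sign too.\<close>

lemma prod_in_signs:
  fixes f :: "'a \<Rightarrow> int"
  assumes "\<And>x. x \<in> A \<Longrightarrow> f x \<in> {1, -1}"
  shows "prod f A \<in> {1, -1}"
  using assms
proof (induction A rule: infinite_finite_induct)
  case (insert x A)
  then have "f x \<in> {1, -1}" "prod f A \<in> {1, -1}" by simp_all
  then show ?case using insert.hyps by auto
qed simp_all

lemma neg_one_power_pc_single_cycle:
  assumes G: "oriented_hypergraph G" and c: "is_contributor G c"
    and C: "cyclic_on (cperm c) C" "C \<subseteq> verts G"
    and fixed: "\<And>v. v \<in> verts G - C \<Longrightarrow> cperm c v = v"
  shows "(-1) ^ pc G c = - component_sign G c C"
proof -
  have step: "is_step G (step_at c v)" if "v \<in> verts G" for v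
    using c that by (simp add: is_contributor_def)
  have "component_sign G c C \<in> {1, -1}"
    unfolding component_sign_def
    using step_sign_in[OF G step] C(2) by (intro prod_in_signs) blast
  moreover have orbit_C: "orbit (cperm c) v = C" if "v \<in> C" for v
    using C(1) that by (simp add: cyclic_on_alldef)
  moreover have backstep: "component_sign G c (orbit (cperm c) v) = -1" if "v \<in> verts G - C" for v
    using fixed[OF that] step_sign_backstep[OF G, of v "cedge c v"] step[of v] that
    by (simp add: component_sign_def orbit_eq_singleton_iff[THEN iffD2] step_at_def)
  \<comment> \<open>Every vertex of \<open>C\<close> has orbit \<open>C\<close>, every other vertex
    a singleton orbit of sign -1. As \<open>C\<close> is itself an orbit, it is nonempty and does
    occur as a component.\<close>
  ultimately have "{K \<in> components_of G c. component_sign G c K = 1} =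
      (if component_sign G c C = 1 then {C} else {})"
    using C by (fastforce simp: components_of_def cyclic_on_def)
  then have "pc G c = (if component_sign G c C = 1 then 1 else 0)"
    by (simp add: pc_def)
  \<comment> \<open>A sign other than 1 must be -1, so the case of no positive component, with power
    1, also gives minus the sign of \<open>C\<close>.\<close>
  with \<open>component_sign G c C \<in> {1, -1}\<close> show ?thesis by auto
qed

lemma cyclic_on_transpose:
  "cyclic_on (transpose k l) {k, l}"
proof -
  have "x \<in> {k, l}" if "x \<in> orbit (transpose k l) k" for x
    using that by induction auto
  \<comment> \<open>\<open>orbit f x\<close> is generated from \<open>f x\<close>, so
    \<open>k\<close> enters its own orbit only on returning from \<open>l\<close>.\<close>
  moreover have "l \<in> orbit (transpose k l) k"
    using orbit.base[of "transpose k l" k] by simp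
  moreover from orbit.step[OF this] have "k \<in> orbit (transpose k l) k"
    by simp
  ultimately have "{k, l} = orbit (transpose k l) k" by blast
  then show ?thesis unfolding cyclic_on_def by blast
qed

lemma cyclic_on_three:
  assumes "p a = b" "p b = c" "p c = a"
  shows "cyclic_on p {a, b, c}"
proof -
  have "x \<in> {a, b, c}" if "x \<in> orbit p a" for x
    using that by induction (use assms in auto)
  moreover have "b \<in> orbit p a" "c \<in> orbit p a" "a \<in> orbit p a"
    using assms by (metis orbit.base orbit.step)+
  ultimately have "{a, b, c} = orbit p a" by blast
  then show ?thesis unfolding cyclic_on_def by blast
qed

text \<open>The steps \<open>(k, k, l)\<close> and \<open>(l, l, k)\<close> each carry a minus sign.
  These two cancel, and the minus sign in front of the component sign remains.\<close>

lemma neg_one_power_pc_c_2cycle: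
  assumes h: "sign_matrix n h" and kl: "1 \<le> k" "k < l" "l \<le> n"
  shows "(-1) ^ pc (full_hypergraph n h) (c_2cycle n k l) = - (h k k * h l k * (h l l * h k l))"
proof -
  have "is_contributor (full_hypergraph n h) (c_2cycle n k l)"
    using c_2cycle_in_A_id[OF kl, of h] by (simp add: A_id_def)
  then have "(-1) ^ pc (full_hypergraph n h) (c_2cycle n k l) =
      - component_sign (full_hypergraph n h) (c_2cycle n k l) {k, l}"
    using kl cyclic_on_transpose[of k l]
    by (intro neg_one_power_pc_single_cycle oriented_hypergraph_full_hypergraph[OF h])
      (auto simp: c_2cycle_def id_contributor_def full_hypergraph_def)
  then show ?thesis
    using kl by (simp add: component_sign_def step_sign_def step_at_def c_2cycle_def
        id_contributor_def full_hypergraph_def)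
qed

text \<open>The minus signs of the three steps and the one in front of the component sign cancel.
  Each step contributes the two entries in the column of its edge.\<close>

lemma neg_one_power_pc_c_3cycle:
  assumes h: "sign_matrix n h" and kl: "2 \<le> k" "k < l" "l \<le> n"
  shows "(-1) ^ pc (full_hypergraph n h) (c_3cycle n k l) =
    h 1 1 * h l 1 * (h l l * h k l) * (h k k * h 1 k)"
proof -
  have "is_contributor (full_hypergraph n h) (c_3cycle n k l)"
    using c_3cycle_in_A_id[OF kl, of h] by (simp add: A_id_def)
  \<comment> \<open>The vertices are listed in the order of traversal, 1 to \<open>l\<close> to
    \<open>k\<close> and back to 1.\<close>
  moreover have "cyclic_on (id(1 := l, l := k, k := 1)) {1, l, k}"
    using kl by (intro cyclic_on_three) auto
  ultimately have "(-1) ^ pc (full_hypergraph n h) (c_3cycle n k l) =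
      - component_sign (full_hypergraph n h) (c_3cycle n k l) {1, l, k}"
    using kl
    by (intro neg_one_power_pc_single_cycle oriented_hypergraph_full_hypergraph[OF h])
      (auto simp: c_3cycle_def id_contributor_def full_hypergraph_def)
  then show ?thesis
    using kl by (simp add: component_sign_def step_sign_def step_at_def c_3cycle_def
        id_contributor_def full_hypergraph_def)
qed

theorem theorem9:
  fixes n :: nat and h :: "nat \<Rightarrow> nat \<Rightarrow> int" and G :: "(nat, nat) hypergraph"
  assumes "sign_matrix n h"
    and "standardized n h"
    and "G = full_hypergraph n h"
  shows "(\<forall>k. 2 \<le> k \<and> k \<le> n \<longrightarrow>
            h k k = - ((-1) ^ pc G (c_2cycle n 1 k)))
       \<and> (\<forall>k l. 2 \<le> k \<and> k < l \<and> l \<le> n \<longrightarrow>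
            h k l = (-1) ^ pc G (c_3cycle n k l) * (-1) ^ pc G (c_2cycle n 1 k)
                      * (-1) ^ pc G (c_2cycle n 1 l))
       \<and> (\<forall>k l. 2 \<le> k \<and> k < l \<and> l \<le> n \<longrightarrow>
            h l k = - ((-1) ^ pc G (c_3cycle n k l) * (-1) ^ pc G (c_2cycle n k l)))"
proof (intro conjI allI impI; elim conjE)
  have sq: "h i j * h i j = 1" if "1 \<le> i" "i \<le> n" "1 \<le> j" "j \<le> n" for i j
  proof -
    have "h i j \<in> {1, -1}" using assms(1) that by (simp add: sign_matrix_def)
    then show ?thesis by auto
  qed
  have one: "h 1 k = 1" "h k 1 = 1" if "1 \<le> k" "k \<le> n" for k
    using assms(2) that by (simp_all add: standardized_def)
  \<comment> \<open>The remaining three entries lie in the first row or column, hence equal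
    1.\<close>
  have pc_1: "(-1) ^ pc G (c_2cycle n 1 k) = - h k k" if "2 \<le> k" "k \<le> n" for k
    using neg_one_power_pc_c_2cycle[OF assms(1), of 1 k] one[of 1] one[of k] that assms(3) by simp
  have pc_2: "(-1) ^ pc G (c_2cycle n k l) = - (h k k * h l k * (h l l * h k l))"
    if "2 \<le> k" "k < l" "l \<le> n" for k l
    using neg_one_power_pc_c_2cycle[OF assms(1), of k l] that assms(3) by simp
  have pc_3: "(-1) ^ pc G (c_3cycle n k l) = h l l * h k l * h k k"
    if "2 \<le> k" "k < l" "l \<le> n" for k l
    using neg_one_power_pc_c_3cycle[OF assms(1) that] one[of 1] one[of k] one[of l] that assms(3)
    by simp
  fix k
  show "h k k = - ((-1) ^ pc G (c_2cycle n 1 k))" if "2 \<le> k" "k \<le> n"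
    using pc_1[OF that] by simp
  fix l assume kl: "2 \<le> k" "k < l" "l \<le> n"
  \<comment> \<open>The two 2-cycles through vertex 1 supply second copies of the diagonal entries,
    which pair off into squares and leave \<open>h k l\<close>.\<close>
  have "h l l * h k l * h k k * (- h k k) * (- h l l) = h k l * (h k k * h k k) * (h l l * h l l)"
    by (simp only: ac_simps minus_mult_minus mult_minus_left mult_minus_right minus_minus)
  also have "\<dots> = h k l"
    using kl sq[of k k] sq[of l l] by simp
  finally show "h k l = (-1) ^ pc G (c_3cycle n k l) * (-1) ^ pc G (c_2cycle n 1 k)
      * (-1) ^ pc G (c_2cycle n 1 l)"
    using kl pc_1[of k] pc_1[of l] pc_3[of k l] by simp
  \<comment> \<open>The 3-cycle and the 2-cycle share all entries but \<open>h l k\<close>, so only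
    that entry survives. The outer minus sign offsets the one in \<open>pc_2\<close>.\<close>
  have "(h l l * h k l * h k k) * (h k k * h l k * (h l l * h k l)) =
      h l k * (h k k * h k k) * (h l l * h l l) * (h k l * h k l)"
    by (simp add: algebra_simps)
  then show "h l k = - ((-1) ^ pc G (c_3cycle n k l) * (-1) ^ pc G (c_2cycle n k l))"
    using kl sq[of k k] sq[of l l] sq[of k l] by (simp add: pc_2 pc_3)
qed

end
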